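(* Let $(X,\gamma)$ be a generalized Minkowski space, let $n\ge 1$, let $p_1,\ldots,p_n\in X$ be distinct points, and let $f:X\to\mathbb{R}$, $f(x)=\sum_{i=1}^n\gamma(p_i-x)$. (a) If $\bar{x}\in X\setminus\{p_1,\ldots,p_n\}$, then $\bar{x}$ is a minimum point of $f$ if and only if, for all $i\in\{1,\ldots,n\}$, there exists a $\gamma$-norming functional $\phi_i\in X^\ast$ of $p_i-\bar{x}$ such that $\sum_{i=1}^n\phi_i=0$. (b) A point $p_j$ ($1\le j\le n$) is a minimum point of $f$ if and only if, for all $i\in\{1,\ldots,n\}$ with $i\ne j$, there exists a $\gamma$-norming functional $\phi_i\in X^\ast$ of $p_i-p_j$ such that $\gamma^\circ\left(-\sum_{i\neq j}\phi_i\right)\le 1$.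
   Context: $X$ is a finite-dimensional real vector space. A gauge on $X$ is a function $\gamma:X\to[0,+\infty)$ such that $\gamma(x)=0$ implies $x=0$; $\gamma(\lambda x)=\lambda\gamma(x)$ for all $x\in X$, $\lambda\ge 0$; and $\gamma(x+y)\le\gamma(x)+\gamma(y)$ for all $x,y\in X$ (no symmetry is assumed). The pair $(X,\gamma)$ is called a generalized Minkowski space. $X^\ast$ is the space of linear functionals on $X$, and $\langle\phi\mid x\rangle$ denotes $\phi(x)$. The polar function of $\gamma$ is $\gamma^\circ:X^\ast\to[0,+\infty)$, $\gamma^\circ(\phi)=\inf\{\lambda>0:\langle\phi\mid x\rangle\le\lambda\gamma(x)\text{ for all }x\in X\}$. A functional $\phi\in X^\ast$ is a $\gamma$-norming functional of (for) $x\in X$ if $\gamma^\circ(\phi)=1$ and $\langle\phi\mid x\rangle=\gamma(x)$. In both parts the functionals $\phi_i$ are to be chosen simultaneously so that the condition on their sum holds. *)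

theory Defs
  imports Complex_Main
begin

definition gauge_function :: "('a::real_vector \<Rightarrow> real) \<Rightarrow> bool" where
  "gauge_function \<gamma> \<longleftrightarrow>
     (\<forall>x. 0 \<le> \<gamma> x) \<and>
     (\<forall>x. \<gamma> x = 0 \<longrightarrow> x = 0) \<and>
     (\<forall>x r. 0 \<le> r \<longrightarrow> \<gamma> (r *\<^sub>R x) = r * \<gamma> x) \<and>
     (\<forall>x y. \<gamma> (x + y) \<le> \<gamma> x + \<gamma> y)"

text \<open>The space is the whole type. Finite-dimensionality is imposed on a type of class
  \<open>real_vector\<close> rather than through \<open>euclidean_space\<close>, which would fix an inner product and
  exclude the zero space.\<close>

definition generalized_Minkowski_space :: "('a::real_vector \<Rightarrow> real) \<Rightarrow> bool" where
  "generalized_Minkowski_space \<gamma> \<longleftrightarrow>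
     (\<exists>B. finite_dimensional_vector_space (scaleR :: real \<Rightarrow> 'a \<Rightarrow> 'a) B) \<and>
     gauge_function \<gamma>"

text \<open>Meaningful for linear \<open>\<phi>\<close>. In a generalized Minkowski space the set below is then nonempty
  and bounded below by 0, so the real-valued \<open>Inf\<close> is a genuine infimum.\<close>

definition polar_function :: "('a::real_vector \<Rightarrow> real) \<Rightarrow> ('a \<Rightarrow> real) \<Rightarrow> real" where
  "polar_function \<gamma> \<phi> = Inf {r. 0 < r \<and> (\<forall>x. \<phi> x \<le> r * \<gamma> x)}"

definition norming_functional ::
    "('a::real_vector \<Rightarrow> real) \<Rightarrow> ('a \<Rightarrow> real) \<Rightarrow> 'a \<Rightarrow> bool" where
  "norming_functional \<gamma> \<phi> x \<longleftrightarrow> linear \<phi> \<and> polar_function \<gamma> \<phi> = 1 \<and> \<phi> x = \<gamma> x"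

definition minimum_point :: "('a \<Rightarrow> real) \<Rightarrow> 'a \<Rightarrow> bool" where
  "minimum_point f x \<longleftrightarrow> (\<forall>y. f x \<le> f y)"

end

theory Submission
  imports Defs "HOL-Analysis.Function_Topology" "HOL-Analysis.Elementary_Normed_Spaces"
begin

text \<open>Minimality of \<open>f\<close> at a point is a statement about subgradients, and both parts of the theorem
  are one criterion read in two ways. The criterion, lemma \<open>minimum_sum_iff_subgradients\<close>, says
  that any point \<open>x\<close> whatsoever minimizes \<open>\<Sum>i. \<gamma> (p i - x)\<close> if and only if there are linear
  \<open>\<phi> i \<le> \<gamma>\<close> with \<open>\<phi> i (p i - x) = \<gamma> (p i - x)\<close> and \<open>\<Sum>i. \<phi> i = 0\<close>.

  Sufficiency is immediate: linear functionals with zero sum that support the summands at \<open>x\<close> bound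
  the value of the sum at any other point from below. For necessity, put \<open>a i = p i - x\<close>. Convexity
  turns minimality into the inequality \<open>0 \<le> \<Sum>i. \<gamma>' (a i) z\<close> for all \<open>z\<close>, where \<open>\<gamma>' (a i)\<close> is the
  one-sided directional derivative of \<open>\<gamma>\<close> at \<open>a i\<close>, again a sublinear function. A form of the
  Hahn-Banach theorem (\<open>linear_below_sum_decomposition\<close>) splits the zero functional, lying below this
  sum, into linear \<open>\<phi> i \<le> \<gamma>' (a i)\<close>; and for linear \<open>\<phi>\<close> the inequality \<open>\<phi> \<le> \<gamma>' a\<close> means just that \<open>\<phi> \<le> \<gamma>\<close> with equality at \<open>a\<close>.

  It remains to translate the condition \<open>\<phi> \<le> \<gamma>\<close> into the language of polar functions: for linear
  \<open>\<phi>\<close> it is equivalent to \<open>\<gamma>\<degree> \<phi> \<le> 1\<close>, and under equality at a nonzero point to \<open>\<gamma>\<degree> \<phi> = 1\<close>. This is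
  where finite dimension enters, because it makes every linear functional bounded by a multiple of
  \<open>\<gamma>\<close>. If \<open>x\<close> is none of the \<open>p i\<close>, all the points \<open>p i - x\<close> are nonzero and the criterion becomes
  part (a). If \<open>x = p j\<close>, the conditions on \<open>\<phi> j\<close> are \<open>\<phi> j \<le> \<gamma>\<close> and
  \<open>\<phi> j = - (\<Sum>i\<noteq>j. \<phi> i)\<close>, and eliminating \<open>\<phi> j\<close> gives part (b).\<close>

section \<open>Sublinear functions and the Hahn-Banach theorem\<close>

definition sublinear :: "('a::real_vector \<Rightarrow> real) \<Rightarrow> bool" where
  "sublinear q \<longleftrightarrow>
     (\<forall>x y. q (x + y) \<le> q x + q y) \<and> (\<forall>r x. 0 \<le> r \<longrightarrow> q (r *\<^sub>R x) = r * q x)"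

lemma sublinear_add: "sublinear q \<Longrightarrow> q (x + y) \<le> q x + q y"
  by (simp add: sublinear_def)

lemma sublinear_scale: "sublinear q \<Longrightarrow> 0 \<le> r \<Longrightarrow> q (r *\<^sub>R x) = r * q x"
  by (simp add: sublinear_def)

lemma sublinear_zero: "sublinear q \<Longrightarrow> q 0 = 0"
  using sublinear_scale[of q 0 0] by simp

lemma sublinear_minus_le: "sublinear q \<Longrightarrow> - q (- x) \<le> q x"
  using sublinear_add[of q x "- x"] sublinear_zero[of q] by simp

lemma sublinear_sum:
  assumes "sublinear q"
  shows "q (\<Sum>b\<in>B. v b) \<le> (\<Sum>b\<in>B. q (v b))"
proof (induction B rule: infinite_finite_induct)
  case (insert b B)
  then show ?case using sublinear_add[OF assms, of "v b" "sum v B"] by simp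
qed (simp_all add: sublinear_zero[OF assms])

lemma sublinear_sum_functions:
  assumes "\<And>i. i \<in> I \<Longrightarrow> sublinear (q i)"
  shows "sublinear (\<lambda>x. \<Sum>i\<in>I. q i x)"
  using assms by (auto simp: sublinear_def sum_distrib_left sum.distrib[symmetric] intro!: sum_mono)

text \<open>One inequality in the homogeneity law suffices, since \<open>r\<close> can be replaced by \<open>1 / r\<close>.\<close>

lemma sublinearI:
  assumes add: "\<And>x y. q (x + y) \<le> q x + q y"
    and scale: "\<And>r x. 0 < r \<Longrightarrow> q (r *\<^sub>R x) \<le> r * q x"
    and zero: "q 0 \<le> 0"
  shows "sublinear q"
proof -
  have "q 0 = 0" using zero scale[of 2 0] by simp
  have "q (r *\<^sub>R x) = r * q x" if "0 \<le> r" for r x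
  proof (cases "r = 0")
    case False
    with that have "0 < r" by simp
    have "q x \<le> inverse r * q (r *\<^sub>R x)" using scale[of "inverse r" "r *\<^sub>R x"] \<open>0 < r\<close> by simp
    then have "r * q x \<le> q (r *\<^sub>R x)" using \<open>0 < r\<close> by (simp add: field_simps)
    then show ?thesis using scale[OF \<open>0 < r\<close>, of x] by simp
  qed (simp add: \<open>q 0 = 0\<close>)
  then show ?thesis using add by (simp add: sublinear_def)
qed

text \<open>Lower bounds for a sum of infima may be checked on independent choices of the indices; this
  replaces the usual approximation by \<open>\<epsilon>\<close>.\<close>

lemma le_sum_cINF:
  fixes g :: "'i \<Rightarrow> 'k \<Rightarrow> real"
  assumes "finite I" and "K \<noteq> {}"
    and "\<And>s. (\<And>i. s i \<in> K) \<Longrightarrow> c \<le> (\<Sum>i\<in>I. g i (s i))"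
  shows "c \<le> (\<Sum>i\<in>I. INF k\<in>K. g i k)"
  using assms(1,3)
proof (induction I arbitrary: c)
  case empty
  then show ?case using \<open>K \<noteq> {}\<close> by force
next
  case (insert j I)
  have "c - g j k \<le> (\<Sum>i\<in>I. INF k\<in>K. g i k)" if "k \<in> K" for k
  proof (rule insert.IH)
    fix s :: "'i \<Rightarrow> 'k" assume s: "\<And>i. s i \<in> K"
    have "c \<le> (\<Sum>i\<in>insert j I. g i ((s(j := k)) i))"
      using insert.prems[of "s(j := k)"] s \<open>k \<in> K\<close> by simp
    also have "\<dots> = g j k + (\<Sum>i\<in>I. g i (s i))"
      using insert.hyps by (auto intro!: sum.cong)
    finally show "c - g j k \<le> (\<Sum>i\<in>I. g i (s i))" by simp
  qed
  then have "c - (\<Sum>i\<in>I. INF k\<in>K. g i k) \<le> (INF k\<in>K. g j k)"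
    by (intro cINF_greatest[OF \<open>K \<noteq> {}\<close>]) (simp add: algebra_simps)
  then show ?case using insert.hyps by simp
qed

text \<open>Three infima below are instances of this rule: the infimum of a chain of sublinear
  functions, the directional derivative, and the infimal convolution.\<close>

lemma sublinear_INF:
  fixes G :: "'a::real_vector \<Rightarrow> 'k \<Rightarrow> real"
  assumes bdd: "\<And>x. bdd_below (G x ` K)"
    and add: "\<And>x y k l. k \<in> K \<Longrightarrow> l \<in> K \<Longrightarrow> \<exists>m\<in>K. G (x + y) m \<le> G x k + G y l"
    and scale: "\<And>r x k. 0 < r \<Longrightarrow> k \<in> K \<Longrightarrow> \<exists>m\<in>K. G (r *\<^sub>R x) m \<le> r * G x k"
    and zero: "\<exists>k\<in>K. G 0 k \<le> 0"
  shows "sublinear (\<lambda>x. INF k\<in>K. G x k)"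
proof (rule sublinearI)
  have ne: "K \<noteq> {}" using zero by auto
  have lower: "(INF k\<in>K. G x k) \<le> c" if "\<exists>m\<in>K. G x m \<le> c" for x c
    using that cINF_lower[OF bdd] order_trans by blast
  show "(INF k\<in>K. G 0 k) \<le> 0" by (rule lower[OF zero])
  show "(INF k\<in>K. G (x + y) k) \<le> (INF k\<in>K. G x k) + (INF k\<in>K. G y k)" for x y
  proof -
    have "(INF k\<in>K. G (x + y) k) - G y l \<le> (INF k\<in>K. G x k)" if "l \<in> K" for l
      using lower[OF add] that by (intro cINF_greatest[OF ne]) (simp add: algebra_simps)
    then have "(INF k\<in>K. G (x + y) k) - (INF k\<in>K. G x k) \<le> (INF k\<in>K. G y k)"
      by (intro cINF_greatest[OF ne]) (simp add: algebra_simps)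
    then show ?thesis by simp
  qed
  show "(INF k\<in>K. G (r *\<^sub>R x) k) \<le> r * (INF k\<in>K. G x k)" if "0 < r" for r x
  proof -
    have "(INF k\<in>K. G (r *\<^sub>R x) k) / r \<le> (INF k\<in>K. G x k)"
      using lower[OF scale[OF that]] that
      by (intro cINF_greatest[OF ne]) (simp add: divide_le_eq mult.commute)
    then show ?thesis using that by (simp add: divide_le_eq mult.commute)
  qed
qed

text \<open>With \<open>s = 1 / t\<close> the expression under the infimum is the difference quotient
  \<open>(q (a + t x) - q a) / t\<close>. This form avoids division, includes \<open>t = \<infinity>\<close> as \<open>s = 0\<close>, and is jointly
  sublinear in \<open>x\<close> and \<open>s\<close>.\<close>

definition directional_derivative :: "('a::real_vector \<Rightarrow> real) \<Rightarrow> 'a \<Rightarrow> 'a \<Rightarrow> real" where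
  "directional_derivative q a x = (INF s\<in>{0..}. q (x + s *\<^sub>R a) - s * q a)"

context
  fixes q :: "'a::real_vector \<Rightarrow> real"
  assumes q: "sublinear q"
begin

lemma bdd_below_difference_quotients:
  "bdd_below ((\<lambda>s. q (x + s *\<^sub>R a) - s * q a) ` {0..})"
proof (rule bdd_belowI2)
  fix s :: real assume "s \<in> {0..}"
  then show "- q (- x) \<le> q (x + s *\<^sub>R a) - s * q a"
    using sublinear_add[OF q, of "x + s *\<^sub>R a" "- x"] sublinear_scale[OF q, of s a] by simp
qed

lemma directional_derivative_le_quotient:
  "0 \<le> s \<Longrightarrow> directional_derivative q a x \<le> q (x + s *\<^sub>R a) - s * q a"
  unfolding directional_derivative_def
  by (rule cINF_lower[OF bdd_below_difference_quotients]) simp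

lemma sublinear_directional_derivative: "sublinear (directional_derivative q a)"
  unfolding directional_derivative_def
proof (rule sublinear_INF[OF bdd_below_difference_quotients])
  show "\<exists>m\<in>{0..}. q (x + y + m *\<^sub>R a) - m * q a \<le> q (x + k *\<^sub>R a) - k * q a + (q (y + l *\<^sub>R a) - l * q a)"
    if "k \<in> {0..}" "l \<in> {0..}" for x y and k l :: real
    using that sublinear_add[OF q, of "x + k *\<^sub>R a" "y + l *\<^sub>R a"]
    by (intro bexI[of _ "k + l"]) (simp_all add: algebra_simps)
  show "\<exists>m\<in>{0..}. q (r *\<^sub>R x + m *\<^sub>R a) - m * q a \<le> r * (q (x + k *\<^sub>R a) - k * q a)"
    if "0 < r" "k \<in> {0..}" for r x and k :: real
    using that sublinear_scale[OF q, of r "x + k *\<^sub>R a"]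
    by (intro bexI[of _ "r * k"]) (simp_all add: algebra_simps)
  show "\<exists>k\<in>{0..}. q (0 + k *\<^sub>R a) - k * q a \<le> 0"
    by (intro bexI[of _ 0]) (simp_all add: sublinear_zero[OF q])
qed

lemma directional_derivative_le: "directional_derivative q a x \<le> q x"
  using directional_derivative_le_quotient[of 0] by simp

lemma directional_derivative_backward: "directional_derivative q a (- a) \<le> - q a"
  using directional_derivative_le_quotient[of 1 a "- a"] by (simp add: sublinear_zero[OF q])

text \<open>The slopes of a convex function along a ray increase with the step, that is, they decrease
  with its reciprocal \<open>s\<close>.\<close>

lemma difference_quotient_antimono:
  assumes "s \<le> t"
  shows "q (x + t *\<^sub>R a) - t * q a \<le> q (x + s *\<^sub>R a) - s * q a"
  using sublinear_add[OF q, of "x + s *\<^sub>R a" "(t - s) *\<^sub>R a"] sublinear_scale[OF q, of "t - s" a] assms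
  by (simp add: algebra_simps)

text \<open>The inequality \<open>\<phi> \<le> q'\<close> at \<open>- a\<close> forces \<open>\<phi> a \<ge> q a\<close>.\<close>

lemma linear_le_directional_derivativeD:
  assumes "linear \<phi>" and "\<And>x. \<phi> x \<le> directional_derivative q a x"
  shows "\<phi> x \<le> q x" and "\<phi> a = q a"
proof -
  show le: "\<phi> x \<le> q x" for x
    using assms(2) directional_derivative_le order_trans by blast
  have "q a \<le> \<phi> a"
    using assms(2)[of "- a"] directional_derivative_backward[of a] linear_neg[OF assms(1), of a] by simp
  then show "\<phi> a = q a" using le[of a] by simp
qed

end

text \<open>A minimal sublinear function coincides with all of its directional derivatives, and
  \<open>q \<le> q' a\<close> at \<open>x\<close>, read with \<open>s = 1\<close>, is superadditivity.\<close>

lemma linear_if_minimal_sublinear: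
  assumes q: "sublinear q" and minimal: "\<And>h. sublinear h \<Longrightarrow> h \<le> q \<Longrightarrow> h = q"
  shows "linear q"
proof -
  have add: "q (x + y) = q x + q y" for x y
  proof -
    have "directional_derivative q y = q"
      by (intro minimal sublinear_directional_derivative q) (simp add: le_fun_def directional_derivative_le q)
    then have "q x \<le> q (x + y) - q y"
      using directional_derivative_le_quotient[OF q, of 1 y x] by simp
    then show ?thesis using sublinear_add[OF q, of x y] by simp
  qed
  have neg: "q (- x) = - q x" for x
    using add[of x "- x"] sublinear_zero[OF q] by simp
  have "q (r *\<^sub>R x) = r *\<^sub>R q x" for r x
  proof (cases "0 \<le> r")
    case False
    then have "q (r *\<^sub>R x) = - q ((- r) *\<^sub>R x)" using neg[of "r *\<^sub>R x"] by simp
    then show ?thesis using False sublinear_scale[OF q, of "- r" x] by simp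
  qed (simp add: sublinear_scale[OF q])
  then show ?thesis using add by (intro linearI)
qed

text \<open>Hahn-Banach: Zorn's lemma gives a minimal sublinear function below \<open>p\<close>. A chain has its
  pointwise infimum as a lower bound, finite because \<open>q x \<ge> - q (- x) \<ge> - p (- x)\<close>.\<close>

lemma exists_linear_below_sublinear:
  fixes p :: "'a::real_vector \<Rightarrow> real"
  assumes p: "sublinear p"
  shows "\<exists>\<phi>. linear \<phi> \<and> (\<forall>x. \<phi> x \<le> p x)"
proof -
  define A where "A = {q. sublinear q \<and> q \<le> p}"
  define P where "P = (\<lambda>q h :: 'a \<Rightarrow> real. h \<le> q)"
  have "\<exists>m\<in>A. \<forall>a\<in>A. P m a \<longrightarrow> a = m"
  proof (rule predicate_Zorn)
    show "partial_order_on A (relation_of P A)"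
      by (auto simp: P_def intro!: partial_order_on_relation_ofI)
  next
    fix C assume "C \<in> Chains (relation_of P A)"
    then have C: "C \<subseteq> A" and chain: "\<And>q h. q \<in> C \<Longrightarrow> h \<in> C \<Longrightarrow> h \<le> q \<or> q \<le> h"
      by (auto simp: Chains_def relation_of_def P_def)
    show "\<exists>u\<in>A. \<forall>a\<in>C. P a u"
    proof (cases "C = {}")
      case True
      then show ?thesis using p by (auto simp: A_def)
    next
      case False
      define u where "u = (\<lambda>x. INF q\<in>C. q x)"
      have sub: "sublinear q" and le_p: "q x \<le> p x" if "q \<in> C" for q x
        using that C by (auto simp: A_def le_fun_def)
      have bdd: "bdd_below ((\<lambda>q. q x) ` C)" for x
      proof (rule bdd_belowI2)
        fix q assume "q \<in> C"
        then show "- p (- x) \<le> q x"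
          using sublinear_minus_le[OF sub, of q x] le_p[of q "- x"] by linarith
      qed
      have u_le: "u x \<le> q x" if "q \<in> C" for q x
        unfolding u_def using cINF_lower[OF bdd that] .
      have "sublinear u"
        unfolding u_def
      proof (rule sublinear_INF[OF bdd])
        fix x y :: 'a and k l assume kl: "k \<in> C" "l \<in> C"
        then obtain m where m: "m \<in> C" "m \<le> k" "m \<le> l" using chain by blast
        then show "\<exists>m\<in>C. m (x + y) \<le> k x + l y"
          using sublinear_add[OF sub, of m x y] add_mono[OF le_funD[OF m(2), of x] le_funD[OF m(3), of y]]
          by (intro bexI[of _ m]) auto
      next
        show "\<exists>m\<in>C. m (r *\<^sub>R x) \<le> r * k x" if "0 < r" "k \<in> C" for r x k
          using that sublinear_scale[OF sub, of k r x] by (intro bexI[of _ k]) auto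
        show "\<exists>k\<in>C. k 0 \<le> 0" using False sublinear_zero[OF sub] by fastforce
      qed
      moreover have "u \<le> p" using False u_le le_p by (fastforce simp: le_fun_def intro: order_trans)
      ultimately show ?thesis using u_le by (intro bexI[of _ u]) (auto simp: A_def P_def le_fun_def)
    qed
  qed
  then obtain m where m: "sublinear m" "m \<le> p" and "\<And>a. sublinear a \<Longrightarrow> a \<le> p \<Longrightarrow> a \<le> m \<Longrightarrow> a = m"
    by (auto simp: A_def P_def)
  then have "linear m" by (meson linear_if_minimal_sublinear order_trans)
  then show ?thesis using m by (auto simp: le_fun_def)
qed

text \<open>Hahn-Banach applied to the infimal convolution of \<open>g\<close> with \<open>y \<mapsto> h (- y) + \<psi> y\<close>.
  Choosing \<open>k = 0\<close> in the infimum shows \<open>\<phi> \<le> g\<close>; choosing \<open>k = x\<close> at the point \<open>- x\<close> shows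
  \<open>\<psi> - \<phi> \<le> h\<close>.\<close>

lemma linear_below_add_decomposition:
  fixes g h \<psi> :: "'a::real_vector \<Rightarrow> real"
  assumes g: "sublinear g" and h: "sublinear h" and \<psi>: "linear \<psi>"
    and le: "\<And>x. \<psi> x \<le> g x + h x"
  shows "\<exists>\<phi>. linear \<phi> \<and> (\<forall>x. \<phi> x \<le> g x) \<and> (\<forall>x. \<psi> x - \<phi> x \<le> h x)"
proof -
  define G where "G = (\<lambda>x k. g (x + k) + h k - \<psi> k)"
  have bdd: "bdd_below (range (G x))" for x
  proof (rule bdd_belowI2)
    fix k
    show "- g (- x) \<le> G x k"
      using sublinear_add[OF g, of "x + k" "- x"] le[of k] by (simp add: G_def)
  qed
  have "sublinear (\<lambda>x. INF k. G x k)"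
  proof (rule sublinear_INF[OF bdd])
    show "\<exists>m\<in>UNIV. G (x + y) m \<le> G x k + G y l" for x y k l
      using sublinear_add[OF g, of "x + k" "y + l"] sublinear_add[OF h, of k l]
      by (intro bexI[of _ "k + l"]) (simp_all add: G_def linear_add[OF \<psi>] algebra_simps)
    show "\<exists>m\<in>UNIV. G (r *\<^sub>R x) m \<le> r * G x k" if "0 < r" for r x k
      using that sublinear_scale[OF g, of r "x + k"] sublinear_scale[OF h, of r k]
      by (intro bexI[of _ "r *\<^sub>R k"]) (simp_all add: G_def linear_scale[OF \<psi>] algebra_simps)
    show "\<exists>k\<in>UNIV. G 0 k \<le> 0"
      by (intro bexI[of _ 0]) (simp_all add: G_def sublinear_zero g h linear_0[OF \<psi>])
  qed
  then obtain \<phi> where \<phi>: "linear \<phi>" and "\<And>x. \<phi> x \<le> (INF k. G x k)"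
    using exists_linear_below_sublinear by blast
  then have below: "\<phi> x \<le> G x k" for x k
    using cINF_lower[OF bdd, of k] order_trans by blast
  have "\<phi> x \<le> g x" for x
    using below[of x 0] by (simp add: G_def sublinear_zero[OF h] linear_0[OF \<psi>])
  moreover have "\<psi> x - \<phi> x \<le> h x" for x
    using below[of "- x" x] by (simp add: G_def sublinear_zero[OF g] linear_neg[OF \<phi>])
  ultimately show ?thesis using \<phi> by blast
qed

lemma linear_below_sum_decomposition:
  fixes q :: "'i \<Rightarrow> 'a::real_vector \<Rightarrow> real" and \<psi> :: "'a \<Rightarrow> real"
  assumes "finite I" and "\<And>i. i \<in> I \<Longrightarrow> sublinear (q i)" and "linear \<psi>"
    and "\<And>x. \<psi> x \<le> (\<Sum>i\<in>I. q i x)"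
  shows "\<exists>\<phi>. (\<forall>i\<in>I. linear (\<phi> i) \<and> (\<forall>x. \<phi> i x \<le> q i x)) \<and> (\<forall>x. (\<Sum>i\<in>I. \<phi> i x) = \<psi> x)"
  using assms
proof (induction I arbitrary: \<psi>)
  case empty
  \<comment> \<open>A linear function that is nowhere positive vanishes.\<close>
  have "\<psi> x = 0" for x
    using empty.prems(3)[of x] empty.prems(3)[of "- x"] linear_neg[OF empty.prems(2), of x] by simp
  then show ?case by simp
next
  case (insert j I)
  have "sublinear (\<lambda>x. \<Sum>i\<in>I. q i x)" using insert.prems(1) by (intro sublinear_sum_functions) auto
  moreover have "\<psi> x \<le> q j x + (\<Sum>i\<in>I. q i x)" for x
    using insert.prems(3)[of x] insert.hyps by simp
  ultimately obtain \<eta> where \<eta>: "linear \<eta>" "\<And>x. \<eta> x \<le> q j x"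
    and rest: "\<And>x. \<psi> x - \<eta> x \<le> (\<Sum>i\<in>I. q i x)"
    using linear_below_add_decomposition[of "q j" "\<lambda>x. \<Sum>i\<in>I. q i x" \<psi>] insert.prems(1,2) by blast
  obtain \<phi> where \<phi>: "\<And>i. i \<in> I \<Longrightarrow> linear (\<phi> i) \<and> (\<forall>x. \<phi> i x \<le> q i x)"
    and sum: "\<And>x. (\<Sum>i\<in>I. \<phi> i x) = \<psi> x - \<eta> x"
    using insert.IH[OF _ linear_compose_sub[OF insert.prems(2) \<eta>(1)] rest] insert.prems(1) by blast
  have "(\<Sum>i\<in>I. (\<phi>(j := \<eta>)) i x) = (\<Sum>i\<in>I. \<phi> i x)" for x
    using insert.hyps by (intro sum.cong) auto
  then have "(\<Sum>i\<in>insert j I. (\<phi>(j := \<eta>)) i x) = \<psi> x" for x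
    using insert.hyps sum by simp
  then show ?case using \<phi> \<eta> by (intro exI[of _ "\<phi>(j := \<eta>)"]) auto
qed

section \<open>Minima of sums of distances\<close>

lemma minimum_sum_iff_subgradients:
  fixes \<gamma> :: "'a::real_vector \<Rightarrow> real" and p :: "'i \<Rightarrow> 'a"
  assumes \<gamma>: "sublinear \<gamma>" and "finite I"
  shows "(\<forall>y. (\<Sum>i\<in>I. \<gamma> (p i - x)) \<le> (\<Sum>i\<in>I. \<gamma> (p i - y))) \<longleftrightarrow>
    (\<exists>\<phi>. (\<forall>i\<in>I. linear (\<phi> i) \<and> (\<forall>z. \<phi> i z \<le> \<gamma> z) \<and> \<phi> i (p i - x) = \<gamma> (p i - x)) \<and>
         (\<forall>z. (\<Sum>i\<in>I. \<phi> i z) = 0))"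
    (is "?minimal \<longleftrightarrow> (\<exists>\<phi>. ?subgradients \<phi>)")
proof
  assume minimal: ?minimal
  let ?a = "\<lambda>i. p i - x"
  have nonneg: "0 \<le> (\<Sum>i\<in>I. directional_derivative \<gamma> (?a i) z)" for z
    unfolding directional_derivative_def
  proof (rule le_sum_cINF[OF \<open>finite I\<close>])
    fix s :: "'i \<Rightarrow> real" assume s: "\<And>i. s i \<in> {0..}"
    \<comment> \<open>By monotonicity of the slopes, all the parameters may be replaced by one common value, which
      is also made positive so that it can be divided by.\<close>
    define t where "t = 1 + (\<Sum>i\<in>I. s i)"
    have "0 < t" using s by (simp add: t_def add_pos_nonneg sum_nonneg)
    have s_le: "s i \<le> t" if "i \<in> I" for i
      using member_le_sum[of i I s] that s \<open>finite I\<close> by (simp add: t_def)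
    have "\<gamma> (z + t *\<^sub>R ?a i) = t * \<gamma> (p i - (x - (1 / t) *\<^sub>R z))" for i
    proof -
      have "z + t *\<^sub>R ?a i = t *\<^sub>R (p i - (x - (1 / t) *\<^sub>R z))"
        using \<open>0 < t\<close> by (simp add: algebra_simps)
      then show ?thesis using sublinear_scale[OF \<gamma>] \<open>0 < t\<close> by simp
    qed
    then have "(\<Sum>i\<in>I. \<gamma> (z + t *\<^sub>R ?a i) - t * \<gamma> (?a i)) =
        t * ((\<Sum>i\<in>I. \<gamma> (p i - (x - (1 / t) *\<^sub>R z))) - (\<Sum>i\<in>I. \<gamma> (?a i)))"
      by (simp add: sum_subtractf sum_distrib_left right_diff_distrib)
    also have "\<dots> \<ge> 0" using minimal \<open>0 < t\<close> by simp
    finally show "0 \<le> (\<Sum>i\<in>I. \<gamma> (z + s i *\<^sub>R ?a i) - s i * \<gamma> (?a i))"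
      using sum_mono[of I, OF difference_quotient_antimono[OF \<gamma> s_le]] by (rule order_trans)
  qed simp
  have "linear (\<lambda>_ :: 'a. 0 :: real)" by (simp add: linear_iff)
  from linear_below_sum_decomposition[OF \<open>finite I\<close> sublinear_directional_derivative[OF \<gamma>] this nonneg]
  obtain \<phi> where \<phi>: "\<And>i. i \<in> I \<Longrightarrow> linear (\<phi> i)"
      "\<And>i z. i \<in> I \<Longrightarrow> \<phi> i z \<le> directional_derivative \<gamma> (?a i) z"
    and "\<forall>z. (\<Sum>i\<in>I. \<phi> i z) = 0"
    by blast
  then have "?subgradients \<phi>"
    using linear_le_directional_derivativeD[OF \<gamma> \<phi>] by blast
  then show "\<exists>\<phi>. ?subgradients \<phi>" by (intro exI)
next
  assume "\<exists>\<phi>. ?subgradients \<phi>"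
  then obtain \<phi> where lin: "\<And>i. i \<in> I \<Longrightarrow> linear (\<phi> i)"
    and le: "\<And>i z. i \<in> I \<Longrightarrow> \<phi> i z \<le> \<gamma> z"
    and eq: "\<And>i. i \<in> I \<Longrightarrow> \<phi> i (p i - x) = \<gamma> (p i - x)"
    and zero: "\<And>z. (\<Sum>i\<in>I. \<phi> i z) = 0"
    by blast
  show ?minimal
  proof
    fix y
    have "(\<Sum>i\<in>I. \<gamma> (p i - x)) = (\<Sum>i\<in>I. \<phi> i (p i - y) + \<phi> i (y - x))"
      using eq lin by (intro sum.cong) (simp_all add: linear_add[symmetric])
    also have "\<dots> = (\<Sum>i\<in>I. \<phi> i (p i - y))" by (simp add: sum.distrib zero)
    also have "\<dots> \<le> (\<Sum>i\<in>I. \<gamma> (p i - y))" by (intro sum_mono le)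
    finally show "(\<Sum>i\<in>I. \<gamma> (p i - x)) \<le> (\<Sum>i\<in>I. \<gamma> (p i - y))" .
  qed
qed

section \<open>Boundedness of linear functionals and the polar function\<close>

lemma sublinear_if_gauge: "gauge_function \<gamma> \<Longrightarrow> sublinear \<gamma>"
  by (simp add: gauge_function_def sublinear_def)

lemma sublinear_continuous_in_coordinates:
  fixes q :: "'a::real_vector \<Rightarrow> real"
  assumes q: "sublinear q"
  shows "continuous_on UNIV (\<lambda>c. q (\<Sum>b\<in>B. c b *\<^sub>R b))"
proof -
  define L where "L = (\<lambda>c. \<Sum>b\<in>B. c b *\<^sub>R b)"
  define M where "M = (\<lambda>b. max (q b) (q (- b)))"
  have termwise: "q (r *\<^sub>R b) \<le> \<bar>r\<bar> * M b" for r b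
  proof (cases "0 \<le> r")
    case True
    then show ?thesis using sublinear_scale[OF q, of r b] by (simp add: M_def mult_left_mono)
  next
    case False
    then show ?thesis
      using sublinear_scale[OF q, of "- r" "- b"] mult_left_mono[of "q (- b)" "M b" "- r"] by (simp add: M_def)
  qed
  have le: "q (L c) \<le> q (L d) + (\<Sum>b\<in>B. \<bar>c b - d b\<bar> * M b)" for c d
  proof -
    have "q (L c) \<le> q (L d) + q (\<Sum>b\<in>B. (c b - d b) *\<^sub>R b)"
      using sublinear_add[OF q, of "L d" "L c - L d"]
      by (simp add: L_def sum_subtractf scaleR_left_diff_distrib)
    also have "q (\<Sum>b\<in>B. (c b - d b) *\<^sub>R b) \<le> (\<Sum>b\<in>B. q ((c b - d b) *\<^sub>R b))"
      by (rule sublinear_sum[OF q])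
    also have "\<dots> \<le> (\<Sum>b\<in>B. \<bar>c b - d b\<bar> * M b)" by (intro sum_mono termwise)
    finally show ?thesis by simp
  qed
  have "((\<lambda>c. q (L c)) \<longlongrightarrow> q (L d)) (at d)" for d
  proof (rule LIM_zero_cancel, rule Lim_null_comparison)
    have "\<bar>q (L c) - q (L d)\<bar> \<le> (\<Sum>b\<in>B. \<bar>c b - d b\<bar> * M b)" for c
      using le[of c d] le[of d c] by (simp add: abs_le_iff abs_minus_commute)
    then show "\<forall>\<^sub>F c in at d. norm (q (L c) - q (L d)) \<le> (\<Sum>b\<in>B. \<bar>c b - d b\<bar> * M b)"
      by simp
    have "continuous_on UNIV (\<lambda>c. \<Sum>b\<in>B. \<bar>c b - d b\<bar> * M b)"
      by (intro continuous_intros continuous_on_product_coordinates)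
    then show "((\<lambda>c. \<Sum>b\<in>B. \<bar>c b - d b\<bar> * M b) \<longlongrightarrow> 0) (at d)"
      unfolding continuous_on_def by (drule_tac bspec[of _ _ d]) simp_all
  qed
  then show ?thesis by (simp add: continuous_on_def L_def)
qed

text \<open>The unit sphere of the coordinate sum norm is compact, the gauge is positive and continuous on
  it, and therefore exceeds some \<open>m > 0\<close> there.\<close>

lemma gauge_ge_coordinate_norm:
  fixes \<gamma> :: "'a::real_vector \<Rightarrow> real"
  assumes \<gamma>: "gauge_function \<gamma>" and B: "finite B" "independent B"
  shows "\<exists>m>0. \<forall>c. m * (\<Sum>b\<in>B. \<bar>c b\<bar>) \<le> \<gamma> (\<Sum>b\<in>B. c b *\<^sub>R b)"
proof -
  note sub = sublinear_if_gauge[OF \<gamma>]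
  have nonneg: "0 \<le> \<gamma> x" and definite: "\<gamma> x = 0 \<Longrightarrow> x = 0" for x
    using \<gamma> by (auto simp: gauge_function_def)
  define L where "L = (\<lambda>c. \<Sum>b\<in>B. c b *\<^sub>R b)"
  \<comment> \<open>Confining the values outside \<open>B\<close> to \<open>[-1, 1]\<close> as well makes \<open>S\<close> a closed subset of a product of
    compact intervals, to which Tychonoff's theorem applies.\<close>
  define S where "S = (\<Pi>\<^sub>E b\<in>UNIV. {-1..1 :: real}) \<inter> {c :: 'a \<Rightarrow> real. (\<Sum>b\<in>B. \<bar>c b\<bar>) = 1}"
  have "compactin (product_topology (\<lambda>_ :: 'a. euclidean) UNIV) (\<Pi>\<^sub>E b\<in>UNIV. {-1..1 :: real})"
    by (simp add: compactin_PiE)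
  then have "compact (\<Pi>\<^sub>E b\<in>(UNIV :: 'a set). {-1..1 :: real})"
    by (simp add: euclidean_product_topology)
  moreover have "closed {c :: 'a \<Rightarrow> real. (\<Sum>b\<in>B. \<bar>c b\<bar>) = 1}"
    by (intro closed_Collect_eq continuous_intros continuous_on_product_coordinates)
  ultimately have "compact S" by (simp add: S_def compact_Int_closed)
  obtain m where "0 < m" and m: "\<And>c. c \<in> S \<Longrightarrow> m \<le> \<gamma> (L c)"
  proof (cases "S = {}")
    case True
    then show ?thesis using that[of 1] by simp
  next
    case False
    have "continuous_on S (\<lambda>c. \<gamma> (L c))"
      unfolding L_def using sublinear_continuous_in_coordinates[OF sub] continuous_on_subset by blast
    then obtain d where d: "d \<in> S" "\<And>c. c \<in> S \<Longrightarrow> \<gamma> (L d) \<le> \<gamma> (L c)"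
      using continuous_attains_inf[OF \<open>compact S\<close> False] by blast
    have "\<gamma> (L d) \<noteq> 0"
    proof
      assume "\<gamma> (L d) = 0"
      then have "(\<Sum>b\<in>B. d b *\<^sub>R b) = 0" using definite by (simp add: L_def)
      then have "d b = 0" if "b \<in> B" for b
        using independentD[OF B(2) B(1) subset_refl] that by blast
      then show False using d(1) by (simp add: S_def)
    qed
    then show ?thesis using that[of "\<gamma> (L d)"] nonneg[of "L d"] d(2) by simp
  qed
  have "m * (\<Sum>b\<in>B. \<bar>c b\<bar>) \<le> \<gamma> (L c)" for c
  proof (cases "(\<Sum>b\<in>B. \<bar>c b\<bar>) = 0")
    case False
    define N where "N = (\<Sum>b\<in>B. \<bar>c b\<bar>)"
    have "0 < N" using False by (simp add: N_def less_le sum_nonneg)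
    define d where "d = (\<lambda>b. if b \<in> B then c b / N else 0)"
    have norm_d: "(\<Sum>b\<in>B. \<bar>d b\<bar>) = 1"
      using \<open>0 < N\<close> by (simp add: d_def N_def[symmetric] flip: sum_divide_distrib)
    moreover have "\<bar>d b\<bar> \<le> 1" for b
      using member_le_sum[of b B "\<lambda>b. \<bar>d b\<bar>"] norm_d B(1) by (cases "b \<in> B") (simp_all add: d_def)
    ultimately have "d \<in> S" by (auto simp: S_def abs_le_iff minus_le_iff)
    have "L c = N *\<^sub>R L d"
      using \<open>0 < N\<close> by (simp add: L_def d_def scaleR_sum_right)
    then show ?thesis
      using m[OF \<open>d \<in> S\<close>] \<open>0 < N\<close> sublinear_scale[OF sub, of N "L d"]
      by (simp add: N_def[symmetric] mult.commute mult_left_mono)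
  qed (simp add: nonneg)
  then show ?thesis using \<open>0 < m\<close> by (auto simp: L_def)
qed

text \<open>This carries the finite-dimensional content of the theorem: without it the set defining the
  polar function could be empty.\<close>

lemma linear_bounded_by_gauge:
  fixes \<gamma> \<phi> :: "'a::real_vector \<Rightarrow> real"
  assumes "generalized_Minkowski_space \<gamma>" and \<phi>: "linear \<phi>"
  shows "\<exists>r>0. \<forall>x. \<phi> x \<le> r * \<gamma> x"
proof -
  obtain B where fd: "finite_dimensional_vector_space (scaleR :: real \<Rightarrow> 'a \<Rightarrow> 'a) B"
    and \<gamma>: "gauge_function \<gamma>"
    using assms(1) by (auto simp: generalized_Minkowski_space_def)
  interpret fd: finite_dimensional_vector_space "scaleR :: real \<Rightarrow> 'a \<Rightarrow> 'a" B by (rule fd)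
  have "independent B" using fd.independent_Basis by (simp add: dependent_raw_def)
  have "span B = UNIV" using fd.span_Basis by (simp add: span_raw_def)
  from gauge_ge_coordinate_norm[OF \<gamma> fd.finite_Basis \<open>independent B\<close>]
  obtain m where "0 < m" and m: "\<And>c. m * (\<Sum>b\<in>B. \<bar>c b\<bar>) \<le> \<gamma> (\<Sum>b\<in>B. c b *\<^sub>R b)"
    by blast
  define M where "M = 1 + (\<Sum>b\<in>B. \<bar>\<phi> b\<bar>)"
  have "0 < M" by (simp add: M_def add_pos_nonneg sum_nonneg)
  have M: "\<bar>\<phi> b\<bar> \<le> M" if "b \<in> B" for b
    using member_le_sum[of b B "\<lambda>b. \<bar>\<phi> b\<bar>"] that fd.finite_Basis by (simp add: M_def)
  have "\<phi> x \<le> M / m * \<gamma> x" for x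
  proof -
    define c where "c = representation B x"
    have x: "x = (\<Sum>b\<in>B. c b *\<^sub>R b)"
      unfolding c_def
      by (rule real_vector.sum_representation_eq[symmetric])
        (simp_all add: \<open>independent B\<close> \<open>span B = UNIV\<close> fd.finite_Basis)
    have "\<phi> x = (\<Sum>b\<in>B. c b * \<phi> b)"
      by (subst x) (simp add: linear_sum[OF \<phi>] linear_scale[OF \<phi>])
    also have "\<dots> \<le> (\<Sum>b\<in>B. M * \<bar>c b\<bar>)"
    proof (rule sum_mono)
      fix b assume "b \<in> B"
      have "c b * \<phi> b \<le> \<bar>c b\<bar> * \<bar>\<phi> b\<bar>" by (simp flip: abs_mult)
      also have "\<dots> \<le> \<bar>c b\<bar> * M" using M[OF \<open>b \<in> B\<close>] by (simp add: mult_left_mono)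
      finally show "c b * \<phi> b \<le> M * \<bar>c b\<bar>" by (simp add: mult.commute)
    qed
    also have "\<dots> = M / m * (m * (\<Sum>b\<in>B. \<bar>c b\<bar>))"
      using \<open>0 < m\<close> by (simp add: sum_distrib_left)
    also have "\<dots> \<le> M / m * \<gamma> x"
      using m[of c] \<open>0 < m\<close> \<open>0 < M\<close> by (intro mult_left_mono) (simp_all add: x[symmetric])
    finally show ?thesis .
  qed
  then show ?thesis using \<open>0 < M\<close> \<open>0 < m\<close> by (intro exI[of _ "M / m"]) simp
qed

lemma polar_function_le:
  assumes "0 < r" and "\<And>x. \<phi> x \<le> r * \<gamma> x"
  shows "polar_function \<gamma> \<phi> \<le> r"
  unfolding polar_function_def using assms by (intro cInf_lower) (auto intro!: bdd_belowI[of _ 0])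

text \<open>The infimum that defines the polar function is itself an admissible constant, being a limit of
  admissible ones.\<close>

lemma polar_function_bound:
  fixes \<gamma> \<phi> :: "'a::real_vector \<Rightarrow> real"
  assumes \<gamma>: "generalized_Minkowski_space \<gamma>" and \<phi>: "linear \<phi>"
  shows "\<phi> x \<le> polar_function \<gamma> \<phi> * \<gamma> x"
proof (cases "x = 0")
  case True
  then show ?thesis
    using \<gamma> sublinear_zero[OF sublinear_if_gauge, of \<gamma>]
    by (simp add: generalized_Minkowski_space_def linear_0[OF \<phi>])
next
  case False
  then have "0 < \<gamma> x"
    using \<gamma> by (auto simp: generalized_Minkowski_space_def gauge_function_def less_le)
  have "\<phi> x / \<gamma> x \<le> polar_function \<gamma> \<phi>"
    unfolding polar_function_def
    using linear_bounded_by_gauge[OF assms] \<open>0 < \<gamma> x\<close>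
    by (intro cInf_greatest) (auto simp: divide_le_eq)
  then show ?thesis using \<open>0 < \<gamma> x\<close> by (simp add: divide_le_eq)
qed

lemma polar_function_le_1_iff:
  fixes \<gamma> \<phi> :: "'a::real_vector \<Rightarrow> real"
  assumes \<gamma>: "generalized_Minkowski_space \<gamma>" and \<phi>: "linear \<phi>"
  shows "polar_function \<gamma> \<phi> \<le> 1 \<longleftrightarrow> (\<forall>x. \<phi> x \<le> \<gamma> x)"
proof
  assume le: "polar_function \<gamma> \<phi> \<le> 1"
  have "0 \<le> \<gamma> x" for x using \<gamma> by (simp add: generalized_Minkowski_space_def gauge_function_def)
  then show "\<forall>x. \<phi> x \<le> \<gamma> x"
    using polar_function_bound[OF assms] mult_right_mono[OF le] by (fastforce intro: order_trans)
qed (simp add: polar_function_le)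

lemma norming_functional_iff:
  fixes \<gamma> \<phi> :: "'a::real_vector \<Rightarrow> real"
  assumes \<gamma>: "generalized_Minkowski_space \<gamma>" and "a \<noteq> 0"
  shows "norming_functional \<gamma> \<phi> a \<longleftrightarrow> linear \<phi> \<and> (\<forall>x. \<phi> x \<le> \<gamma> x) \<and> \<phi> a = \<gamma> a"
proof -
  have "0 < \<gamma> a"
    using \<gamma> \<open>a \<noteq> 0\<close> by (auto simp: generalized_Minkowski_space_def gauge_function_def less_le)
  \<comment> \<open>Equality at a nonzero point excludes a polar value less than 1.\<close>
  then have "1 \<le> polar_function \<gamma> \<phi>" if "linear \<phi>" "\<phi> a = \<gamma> a"
    using polar_function_bound[OF \<gamma> that(1), of a] that(2) by simp
  then show ?thesis
    using polar_function_le_1_iff[OF \<gamma>, of \<phi>] by (auto simp: norming_functional_def)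
qed

section \<open>Fermat-Torricelli points\<close>

theorem theorem3p1:
  fixes \<gamma> :: "'a::real_vector \<Rightarrow> real"
    and n :: nat
    and p :: "nat \<Rightarrow> 'a"
    and f :: "'a \<Rightarrow> real"
  assumes "generalized_Minkowski_space \<gamma>"
    and "1 \<le> n"
    and "inj_on p {1..n}"
    and "\<And>x. f x = (\<Sum>i\<in>{1..n}. \<gamma> (p i - x))"
  shows "(\<forall>xbar. xbar \<notin> p ` {1..n} \<longrightarrow>
            (minimum_point f xbar \<longleftrightarrow>
              (\<exists>\<phi> :: nat \<Rightarrow> 'a \<Rightarrow> real.
                 (\<forall>i\<in>{1..n}. norming_functional \<gamma> (\<phi> i) (p i - xbar)) \<and>
                 (\<forall>x. (\<Sum>i\<in>{1..n}. \<phi> i x) = 0)))) \<and>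
         (\<forall>j\<in>{1..n}.
            minimum_point f (p j) \<longleftrightarrow>
              (\<exists>\<phi> :: nat \<Rightarrow> 'a \<Rightarrow> real.
                 (\<forall>i\<in>{1..n} - {j}. norming_functional \<gamma> (\<phi> i) (p i - p j)) \<and>
                 polar_function \<gamma> (\<lambda>x. - (\<Sum>i\<in>{1..n} - {j}. \<phi> i x)) \<le> 1))"
proof (intro conjI allI impI ballI)
  note \<gamma> = assms(1)
  have sub: "sublinear \<gamma>"
    using \<gamma> by (simp add: generalized_Minkowski_space_def sublinear_if_gauge)
  have criterion: "minimum_point f x \<longleftrightarrow>
      (\<exists>\<phi>. (\<forall>i\<in>{1..n}. linear (\<phi> i) \<and> (\<forall>z. \<phi> i z \<le> \<gamma> z) \<and> \<phi> i (p i - x) = \<gamma> (p i - x)) \<and>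
           (\<forall>z. (\<Sum>i\<in>{1..n}. \<phi> i z) = 0))" for x
    unfolding minimum_point_def assms(4) by (rule minimum_sum_iff_subgradients[OF sub]) simp
  {
    fix x assume "x \<notin> p ` {1..n}"
    then have "p i - x \<noteq> 0" if "i \<in> {1..n}" for i using that by auto
    then show "minimum_point f x \<longleftrightarrow>
        (\<exists>\<phi>. (\<forall>i\<in>{1..n}. norming_functional \<gamma> (\<phi> i) (p i - x)) \<and> (\<forall>z. (\<Sum>i\<in>{1..n}. \<phi> i z) = 0))"
      unfolding criterion by (simp add: norming_functional_iff[OF \<gamma>])
  next
    fix j assume j: "j \<in> {1..n}"
    let ?J = "{1..n} - {j}"
    have "p i - p j \<noteq> 0" if "i \<in> ?J" for i
      using that j inj_onD[OF assms(3), of i j] by auto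
    then have norming: "norming_functional \<gamma> \<psi> (p i - p j) \<longleftrightarrow>
        linear \<psi> \<and> (\<forall>x. \<psi> x \<le> \<gamma> x) \<and> \<psi> (p i - p j) = \<gamma> (p i - p j)" if "i \<in> ?J" for i \<psi>
      using that by (simp add: norming_functional_iff[OF \<gamma>])
    have split: "(\<Sum>i\<in>{1..n}. g i) = g j + (\<Sum>i\<in>?J. g i)" for g :: "nat \<Rightarrow> real"
      using j by (simp add: sum.remove)
    show "minimum_point f (p j) \<longleftrightarrow>
        (\<exists>\<phi>. (\<forall>i\<in>?J. norming_functional \<gamma> (\<phi> i) (p i - p j)) \<and>
             polar_function \<gamma> (\<lambda>x. - (\<Sum>i\<in>?J. \<phi> i x)) \<le> 1)"
    proof
      assume "minimum_point f (p j)"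
      then obtain \<phi> where \<phi>: "\<And>i. i \<in> {1..n} \<Longrightarrow>
          linear (\<phi> i) \<and> (\<forall>z. \<phi> i z \<le> \<gamma> z) \<and> \<phi> i (p i - p j) = \<gamma> (p i - p j)"
        and zero: "\<And>z. (\<Sum>i\<in>{1..n}. \<phi> i z) = 0"
        unfolding criterion by blast
      have "(\<lambda>x. - (\<Sum>i\<in>?J. \<phi> i x)) = \<phi> j"
        using zero[unfolded split] by (simp add: fun_eq_iff add_eq_0_iff)
      then have "polar_function \<gamma> (\<lambda>x. - (\<Sum>i\<in>?J. \<phi> i x)) \<le> 1"
        using polar_function_le_1_iff[OF \<gamma>, of "\<phi> j"] \<phi>[OF j] by simp
      then show "\<exists>\<phi>. (\<forall>i\<in>?J. norming_functional \<gamma> (\<phi> i) (p i - p j)) \<and>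
          polar_function \<gamma> (\<lambda>x. - (\<Sum>i\<in>?J. \<phi> i x)) \<le> 1"
        using \<phi> norming by (intro exI[of _ \<phi>]) simp
    next
      assume "\<exists>\<phi>. (\<forall>i\<in>?J. norming_functional \<gamma> (\<phi> i) (p i - p j)) \<and>
          polar_function \<gamma> (\<lambda>x. - (\<Sum>i\<in>?J. \<phi> i x)) \<le> 1"
      then obtain \<phi> where \<phi>: "\<And>i. i \<in> ?J \<Longrightarrow> norming_functional \<gamma> (\<phi> i) (p i - p j)"
        and polar: "polar_function \<gamma> (\<lambda>x. - (\<Sum>i\<in>?J. \<phi> i x)) \<le> 1"
        by blast
      define \<psi> where "\<psi> = (\<lambda>x. - (\<Sum>i\<in>?J. \<phi> i x))"
      have "linear \<psi>"
        unfolding \<psi>_def using \<phi> by (intro linear_compose_neg linear_compose_sum) (auto simp: norming_functional_def)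
      then have "\<forall>x. \<psi> x \<le> \<gamma> x" using polar polar_function_le_1_iff[OF \<gamma>] by (simp add: \<psi>_def)
      moreover have "(\<Sum>i\<in>?J. (\<phi>(j := \<psi>)) i z) = (\<Sum>i\<in>?J. \<phi> i z)" for z
        by (intro sum.cong) auto
      then have "(\<Sum>i\<in>{1..n}. (\<phi>(j := \<psi>)) i z) = 0" for z
        unfolding split by (simp add: \<psi>_def)
      ultimately show "minimum_point f (p j)"
        unfolding criterion using \<phi> norming \<open>linear \<psi>\<close> sublinear_zero[OF sub]
        by (intro exI[of _ "\<phi>(j := \<psi>)"]) (auto simp: linear_0)
    qed
  }
qed

end
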